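(* Let $n\ge 2k$ and let $\mathcal{F}\subset\binom{[n]}{k}$ be an intersecting family. Then $$\mathrm{co}_2(\mathcal{F})\le\binom{n-1}{k-1}\bigl(1+(n-k+1)(k-1)\bigr).$$ If $n>2k$, equality holds only if $\mathcal{F}\cong\{F\in\binom{[n]}{k}:1\in F\}$. If $n=2k$, equality holds only if $\mathcal{F}\cong\{F\in\binom{[2k]}{k}:1\in F\}$ or $\mathcal{F}\cong\binom{[2k-1]}{k}$.
   Context: $[n]=\{1,\dots,n\}$ and $\binom{V}{k}$ is the family of $k$-element subsets of $V$; $n,k$ are positive integers. A family $\mathcal{F}$ is intersecting if $F\cap F'\neq\emptyset$ for all $F,F'\in\mathcal{F}$. For $\mathcal{F}\subset\binom{[n]}{k}$ and $E\subseteq[n]$, $d(E)$ is the number of members of $\mathcal{F}$ containing $E$, and $\mathrm{co}_2(\mathcal{F})=\sum_{E\in\binom{[n]}{k-1}}d(E)^2$. The symbol $\cong$ denotes equality up to a permutation of the ground set $[n]$; $\binom{[2k-1]}{k}$ is regarded as a family on the ground set $[2k]$. *)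

theory Defs
  imports "HOL-Library.Ramsey" "HOL-Combinatorics.Permutations"
begin

text \<open>The family of all \<open>k\<close>-element subsets of \<open>V\<close> is the library's \<^term>\<open>nsets V k\<close>.\<close>

text \<open>The two members need not be distinct, so no member of an intersecting family is empty.\<close>

definition intersecting :: "'a set set \<Rightarrow> bool"
  where "intersecting \<F> \<longleftrightarrow> (\<forall>F\<in>\<F>. \<forall>F'\<in>\<F>. F \<inter> F' \<noteq> {})"

definition family_degree :: "'a set set \<Rightarrow> 'a set \<Rightarrow> nat"
  where "family_degree \<F> E = card {F \<in> \<F>. E \<subseteq> F}"

definition co2 :: "nat \<Rightarrow> nat \<Rightarrow> nat set set \<Rightarrow> nat"
  where "co2 n k \<F> = (\<Sum>E\<in>nsets {1..n} (k - 1). (family_degree \<F> E)\<^sup>2)"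

definition family_iso :: "'a set \<Rightarrow> 'a set set \<Rightarrow> 'a set set \<Rightarrow> bool"
  where "family_iso V \<F> \<G> \<longleftrightarrow> (\<exists>p. p permutes V \<and> (\<lambda>F. p ` F) ` \<F> = \<G>)"

end

theory Submission
  imports Defs "HOL-Combinatorics.Multiset_Permutations"
begin

text \<open>Counting pairs of members that share a given \<open>(k - 1)\<close>-set gives
\<open>co\<^sub>2(\<F>) = k |\<F>| + e\<close>, where \<open>e\<close> is the number of ordered pairs of members meeting
in exactly \<open>k - 1\<close> points (\<open>sum_degree_squares\<close>). It is therefore enough to bound
\<open>|\<F>|\<close>, which is the Erdos--Ko--Rado theorem, and to show \<open>e \<le> (k - 1)(n - k) |\<F>|\<close>; in a
star both are equalities.

Katona's cycle argument yields both bounds at once. Place the points of \<open>V\<close> on a cycle in some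
order and mark the starting points of those arcs of length \<open>k\<close> that belong to \<open>\<F>\<close>. At most
\<open>k\<close> positions are marked, because an arc and the one starting where it ends are disjoint. If some
position is marked, then some marked position is followed by an unmarked one, so the number of
consecutive marked pairs is at most \<open>r - 1\<close>, where \<open>r\<close> counts the marks, and
\<open>r - 1 \<le> r (k - 1) / k\<close> because \<open>r \<le> k\<close>. Two consecutive arcs meet in \<open>k - 1\<close> points, and
averaging over all orders meets every \<open>k\<close>-set and every such pair of \<open>k\<close>-sets equally often
(\<open>average_over_orders\<close>), so that the two statements about marks become the two bounds.

In the case of equality every order carries exactly \<open>k\<close> marks, and these are consecutive
(\<open>periodic_separated.tight_interval\<close>). Suppose that \<open>S \<union> {a}\<close> is a member and
\<open>S \<union> {b}\<close> is not. An order in which \<open>a\<close>, the points of \<open>S\<close> and \<open>b\<close> follow each other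
fixes where the block of marks ends, and arranging the points within \<open>S\<close> and outside
\<open>S \<union> {a, b}\<close> suitably turns any \<open>k\<close>-set containing \<open>a\<close> but not \<open>b\<close> into one of the arcs of that block (\<open>swap_forces\<close>). This rigidity leaves only stars and,
for \<open>n = 2k\<close>, the \<open>k\<close>-sets avoiding a fixed point.\<close>

section \<open>Degrees and pairs of members\<close>

definition meeting_pairs :: "'a set set \<Rightarrow> nat \<Rightarrow> ('a set \<times> 'a set) set"
  where "meeting_pairs \<F> j = {(A, B). A \<in> \<F> \<and> B \<in> \<F> \<and> card (A \<inter> B) = j}"

lemma meeting_pairs_subset: "meeting_pairs \<F> j \<subseteq> \<F> \<times> \<F>"
  by (auto simp: meeting_pairs_def)

lemma finite_meeting_pairs: "finite \<F> \<Longrightarrow> finite (meeting_pairs \<F> j)"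
  by (rule finite_subset[OF meeting_pairs_subset]) simp

lemma card_meeting_pairs_diagonal:
  assumes "\<F> \<subseteq> nsets V k"
  shows "card (meeting_pairs \<F> k) = card \<F>"
proof -
  have k: "finite A \<and> card A = k" if "A \<in> \<F>" for A
    using that assms by (auto simp: nsets_def)
  have "A = B" if "A \<in> \<F>" "B \<in> \<F>" "card (A \<inter> B) = k" for A B
  proof -
    have "A \<inter> B = A"
      by (rule card_subset_eq) (use k that in auto)
    moreover have "A \<inter> B = B"
      by (rule card_subset_eq) (use k that in auto)
    ultimately show ?thesis by simp
  qed
  then have "meeting_pairs \<F> k = (\<lambda>A. (A, A)) ` \<F>"
    using k by (auto simp: meeting_pairs_def image_iff)
  then show ?thesis by (simp add: card_image inj_on_def)
qed

text \<open>The square of a degree counts ordered pairs of members above a common \<open>(k - 1)\<close>-set. A pair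
\<open>(A, B)\<close> is seen from \<open>card (A \<inter> B) choose (k - 1)\<close> such sets, which is \<open>k\<close> if \<open>A = B\<close>,
\<open>1\<close> if the two meet in \<open>k - 1\<close> points, and \<open>0\<close> otherwise.\<close>

lemma sum_degree_squares:
  assumes V: "finite V" and F: "\<F> \<subseteq> nsets V k" and k: "k \<ge> 1"
  shows "(\<Sum>E\<in>nsets V (k - 1). (family_degree \<F> E)\<^sup>2)
       = k * card \<F> + card (meeting_pairs \<F> (k - 1))"
proof -
  have finF: "finite \<F>"
    using F V finite_imp_finite_nsets finite_subset by blast
  have deg: "(family_degree \<F> E)\<^sup>2 = (\<Sum>(A,B)\<in>\<F> \<times> \<F>. if E \<subseteq> A \<inter> B then 1 else 0)" for E
  proof -
    have "(family_degree \<F> E)\<^sup>2 = card ({A\<in>\<F>. E \<subseteq> A} \<times> {A\<in>\<F>. E \<subseteq> A})"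
      by (simp add: family_degree_def power2_eq_square card_cartesian_product)
    also have "{A\<in>\<F>. E \<subseteq> A} \<times> {A\<in>\<F>. E \<subseteq> A} = {p \<in> \<F> \<times> \<F>. E \<subseteq> fst p \<inter> snd p}"
      by auto
    also have "card \<dots> = (\<Sum>p\<in>\<F> \<times> \<F>. if E \<subseteq> fst p \<inter> snd p then 1 else 0)"
      using finF by (simp add: sum.If_cases Int_def)
    finally show ?thesis by (simp add: case_prod_unfold)
  qed
  have count: "(\<Sum>E\<in>nsets V (k - 1). if E \<subseteq> A \<inter> B then 1 else 0)
      = k * (if card (A \<inter> B) = k then 1 else 0) + (if card (A \<inter> B) = k - 1 then 1 else (0::nat))"
    if "A \<in> \<F>" "B \<in> \<F>" for A B
  proof -
    have A: "A \<subseteq> V" "finite A" "card A = k"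
      using that F by (auto simp: nsets_def)
    have "(\<Sum>E\<in>nsets V (k - 1). if E \<subseteq> A \<inter> B then 1 else 0)
        = card {E \<in> nsets V (k - 1). E \<subseteq> A \<inter> B}"
      using V by (simp add: sum.If_cases Int_def finite_imp_finite_nsets)
    also have "{E \<in> nsets V (k - 1). E \<subseteq> A \<inter> B} = nsets (A \<inter> B) (k - 1)"
      using A by (auto simp: nsets_def)
    also have "card \<dots> = card (A \<inter> B) choose (k - 1)"
      by (rule card_nsets)
    finally have eq: "(\<Sum>E\<in>nsets V (k - 1). if E \<subseteq> A \<inter> B then 1 else 0) = card (A \<inter> B) choose (k - 1)" .
    have "card (A \<inter> B) \<le> k"
      using A card_mono by (metis inf_le1)
    then consider "card (A \<inter> B) = k" | "card (A \<inter> B) = k - 1" | "card (A \<inter> B) < k - 1"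
      by linarith
    then show ?thesis
      unfolding eq
    proof cases
      case 1
      then show "card (A \<inter> B) choose (k - 1) = k * (if card (A \<inter> B) = k then 1 else 0)
          + (if card (A \<inter> B) = k - 1 then 1 else (0::nat))"
        using k by (simp add: binomial_symmetric)
    qed (use k in \<open>auto simp: binomial_eq_0\<close>)
  qed
  have ind: "(\<Sum>(A,B)\<in>\<F> \<times> \<F>. if card (A \<inter> B) = j then 1 else 0) = card (meeting_pairs \<F> j)" for j
  proof -
    have "meeting_pairs \<F> j = {p \<in> \<F> \<times> \<F>. card (fst p \<inter> snd p) = j}"
      by (auto simp: meeting_pairs_def)
    then show ?thesis
      using finF by (simp add: sum.If_cases Int_def case_prod_unfold)
  qed
  have "(\<Sum>E\<in>nsets V (k - 1). (family_degree \<F> E)\<^sup>2)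
      = (\<Sum>(A,B)\<in>\<F> \<times> \<F>. \<Sum>E\<in>nsets V (k - 1). if E \<subseteq> A \<inter> B then 1 else 0)"
    unfolding deg by (subst sum.swap) (simp add: case_prod_unfold)
  also have "\<dots> = (\<Sum>(A,B)\<in>\<F> \<times> \<F>. k * (if card (A \<inter> B) = k then 1 else 0)
                     + (if card (A \<inter> B) = k - 1 then 1 else 0))"
    by (rule sum.cong) (use count in auto)
  also have "\<dots> = k * card (meeting_pairs \<F> k) + card (meeting_pairs \<F> (k - 1))"
    unfolding ind[symmetric] by (simp add: case_prod_unfold sum.distrib sum_distrib_left )
  finally show ?thesis
    by (simp add: card_meeting_pairs_diagonal[OF F])
qed

text \<open>For the complete family all degrees are \<open>n - k + 1\<close>, so the number of pairs can be read off from
the previous identity.\<close>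

lemma card_meeting_pairs_nsets:
  assumes V: "finite V" "card V = n" and k: "1 \<le> k" "k \<le> n"
  shows "card (meeting_pairs (nsets V k) (k - 1)) = (n choose k) * (k * (n - k))"
proof -
  have deg: "family_degree (nsets V k) E = n - k + 1" if "E \<in> nsets V (k - 1)" for E
  proof -
    have E: "E \<subseteq> V" "finite E" "card E = k - 1" using that by (auto simp: nsets_def)
    have "{F \<in> nsets V k. E \<subseteq> F} = (\<lambda>y. insert y E) ` (V - E)"
    proof (intro equalityI subsetI)
      fix F assume "F \<in> {F \<in> nsets V k. E \<subseteq> F}"
      then have F: "F \<subseteq> V" "finite F" "card F = k" "E \<subseteq> F" by (auto simp: nsets_def)
      then have "card (F - E) = 1" using E k by (simp add: card_Diff_subset)
      then obtain y where "F - E = {y}" by (auto simp: card_1_singleton_iff)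
      then have "F = insert y E" "y \<in> V - E" using F by auto
      then show "F \<in> (\<lambda>y. insert y E) ` (V - E)" by blast
    qed (use E k in \<open>auto simp: nsets_def\<close>)
    moreover have "inj_on (\<lambda>y. insert y E) (V - E)" by (auto simp: inj_on_def)
    moreover have "card (V - E) = n - k + 1"
      using E V k by (simp add: card_Diff_subset)
    ultimately show ?thesis by (simp add: family_degree_def card_image)
  qed
  have "(n choose (k - 1)) * (n - k + 1) = (n choose k) * k"
  proof -
    have "n - (k - 1) = n - k + 1" using k by simp
    then have "(n - k + 1) * (n choose (k - 1)) = k * (n choose k)"
      using binomial_absorb_comp[of n "k - 1"] times_binomial_minus1_eq[of k n] k by simp
    then show ?thesis by (simp only: mult.commute)
  qed
  then have "(n choose (k - 1)) * (n - k + 1)\<^sup>2 = (n choose k) * k * (n - k + 1)"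
    by (metis mult.assoc power2_eq_square)
  moreover have "(\<Sum>E\<in>nsets V (k - 1). (family_degree (nsets V k) E)\<^sup>2)
      = (n choose (k - 1)) * (n - k + 1)\<^sup>2"
    using deg V by (simp add: card_nsets)
  ultimately have "(n choose k) * k * (n - k + 1)
      = k * (n choose k) + card (meeting_pairs (nsets V k) (k - 1))"
    using sum_degree_squares[OF V(1) order_refl k(1)] V by (simp add: card_nsets)
  then show ?thesis by (simp add: algebra_simps)
qed

section \<open>Arcs of a cyclic order\<close>

text \<open>A list is read as a cyclic order by indexing it with integers modulo its length. Allowing all
integers as positions turns rotation into translation and avoids wrap-around cases.\<close>

definition cyc :: "'a list \<Rightarrow> int \<Rightarrow> 'a"
  where "cyc xs x = xs ! nat (x mod int (length xs))"

definition arc :: "nat \<Rightarrow> 'a list \<Rightarrow> int \<Rightarrow> 'a set"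
  where "arc k xs i = cyc xs ` {i..<i + int k}"

lemma cyc_eq_iff:
  assumes "distinct xs" "xs \<noteq> []"
  shows "cyc xs x = cyc xs y \<longleftrightarrow> x mod int (length xs) = y mod int (length xs)"
proof -
  have "0 \<le> z mod int (length xs)" "nat (z mod int (length xs)) < length xs" for z
    using assms by (simp_all add: nat_less_iff)
  then show ?thesis
    unfolding cyc_def using assms by (simp add: nth_eq_iff_index_eq nat_eq_iff)
qed

lemma cyc_inj_on:
  assumes "distinct xs"
  shows "inj_on (cyc xs) {a..<a + int (length xs)}"
proof (cases "xs = []")
  case False
  show ?thesis
  proof (rule inj_onI)
    fix x y assume xy: "x \<in> {a..<a + int (length xs)}" "y \<in> {a..<a + int (length xs)}"
      and "cyc xs x = cyc xs y"
    then have "int (length xs) dvd x - y"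
      using assms False by (simp add: cyc_eq_iff mod_eq_dvd_iff)
    then show "x = y"
      using xy zdvd_imp_le[of "int (length xs)" "x - y"] zdvd_imp_le[of "int (length xs)" "y - x"]
      by (smt (verit) atLeastLessThan_iff dvd_diff_commute)
  qed
qed simp

lemma arc_periodic: "arc k xs (i + int (length xs)) = arc k xs i"
proof -
  have "{i + int (length xs)..<i + int (length xs) + int k} = (+) (int (length xs)) ` {i..<i + int k}"
    by (simp add: image_add_atLeastLessThan algebra_simps)
  moreover have "cyc xs (int (length xs) + x) = cyc xs x" for x
    by (simp add: cyc_def)
  ultimately show ?thesis
    by (simp only: arc_def image_image)
qed

lemma arc_subset: "xs \<noteq> [] \<Longrightarrow> arc k xs i \<subseteq> set xs"
  by (auto simp: arc_def cyc_def nat_less_iff intro!: nth_mem)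

lemma arc_Int:
  assumes "distinct xs" "k + d \<le> length xs"
  shows "arc k xs i \<inter> arc k xs (i + int d) = cyc xs ` {i + int d..<i + int k}"
proof -
  have "arc k xs i \<inter> arc k xs (i + int d)
      = cyc xs ` ({i..<i + int k} \<inter> {i + int d..<i + int d + int k})"
    unfolding arc_def
    by (rule inj_on_image_Int[OF cyc_inj_on[OF assms(1), of i], symmetric]) (use assms in auto)
  also have "{i..<i + int k} \<inter> {i + int d..<i + int d + int k} = {i + int d..<i + int k}"
    by auto
  finally show ?thesis .
qed

lemma card_arc_Int:
  assumes "distinct xs" "k + d \<le> length xs"
  shows "card (arc k xs i \<inter> arc k xs (i + int d)) = k - d"
proof -
  have "inj_on (cyc xs) {i + int d..<i + int k}"
    by (rule inj_on_subset[OF cyc_inj_on[OF assms(1), of i]]) (use assms in auto)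
  then show ?thesis
    by (simp add: arc_Int[OF assms] card_image)
qed

lemma arc_in_nsets:
  assumes "distinct xs" "k \<le> length xs" "xs \<noteq> []"
  shows "arc k xs i \<in> nsets (set xs) k"
  using card_arc_Int[of xs k 0 i] arc_subset[of xs k i] assms
  by (auto simp: nsets_def arc_def)

lemma arc_disjoint:
  assumes "distinct xs" "i + int k \<le> j" "j \<le> i + int (length xs) - int k"
  shows "arc k xs i \<inter> arc k xs j = {}"
proof -
  define d where "d = nat (j - i)"
  have "j = i + int d" "k + d \<le> length xs" using assms by (auto simp: d_def)
  then show ?thesis using arc_Int[OF assms(1), of k d i] assms(2) by simp
qed

lemma arc_map:
  assumes "xs \<noteq> []"
  shows "arc k (map q xs) i = q ` arc k xs i"
  using assms by (auto simp: arc_def cyc_def image_image nat_less_iff)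

text \<open>Arcs that do not wrap around are blocks of the list; this is how a concrete order is made to
contain prescribed sets as arcs.\<close>

lemma arc_append:
  assumes "length ys = k"
  shows "arc k (us @ ys @ vs) (int (length us)) = set ys"
proof -
  have "cyc (us @ ys @ vs) (int (length us) + int j) = ys ! j" if "j < k" for j
    using that assms by (simp add: cyc_def nat_add_distrib nth_append flip: of_nat_add)
  moreover have "{int (length us)..<int (length us) + int k} = (\<lambda>j. int (length us) + int j) ` {..<k}"
  proof -
    have "x \<in> (\<lambda>j. int (length us) + int j) ` {..<k}"
      if "int (length us) \<le> x" "x < int (length us) + int k" for x
      using that by (intro image_eqI[where x = "nat (x - int (length us))"]) auto
    then show ?thesis by auto
  qed
  ultimately have "arc k (us @ ys @ vs) (int (length us)) = (\<lambda>j. ys ! j) ` {..<k}"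
    by (simp add: arc_def image_image)
  then show ?thesis using assms by (auto simp: set_conv_nth)
qed

section \<open>Averaging over all orders\<close>

text \<open>Two sets cut \<open>V\<close> into four cells, whose sizes are determined by the sizes of the sets and of
their intersection. Colouring each point by its cell, the two colourings use every colour equally
often and hence differ by a permutation.\<close>

lemma permutes_pair_of_sets:
  assumes V: "finite V" and sub: "A \<subseteq> V" "B \<subseteq> V" "C \<subseteq> V" "D \<subseteq> V"
    and card: "card A = card C" "card B = card D" "card (A \<inter> B) = card (C \<inter> D)"
  obtains q where "q permutes V" "q ` A = C" "q ` B = D"
proof -
  let ?f = "\<lambda>x. (x \<in> A, x \<in> B)" and ?g = "\<lambda>x. (x \<in> C, x \<in> D)"
  have fibre: "card {x \<in> V. (x \<in> P) = u \<and> (x \<in> Q) = v}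
      = (if u then if v then card (P \<inter> Q) else card P - card (P \<inter> Q)
         else if v then card Q - card (P \<inter> Q) else card V - (card P + card Q - card (P \<inter> Q)))"
    if "P \<subseteq> V" "Q \<subseteq> V" for P Q u v
  proof -
    have fPQ: "finite P" "finite Q" using V that finite_subset by blast+
    have "{x \<in> V. x \<in> P \<and> x \<in> Q} = P \<inter> Q" "{x \<in> V. x \<in> P \<and> x \<notin> Q} = P - P \<inter> Q"
      "{x \<in> V. x \<notin> P \<and> x \<in> Q} = Q - P \<inter> Q" "{x \<in> V. x \<notin> P \<and> x \<notin> Q} = V - (P \<union> Q)"
      using that by auto
    moreover have "card (P \<union> Q) = card P + card Q - card (P \<inter> Q)"
      using card_Un_Int[OF fPQ] by simp
    ultimately show ?thesis
      using that fPQ by (cases u; cases v) (simp_all add: card_Diff_subset)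
  qed
  have "image_mset ?f (mset_set V) = image_mset ?g (mset_set V)"
  proof (rule multiset_eqI)
    fix c :: "bool \<times> bool"
    obtain u v where c: "c = (u, v)" by (cases c)
    have "card {x \<in> V. ?f x = c} = card {x \<in> V. ?g x = c}"
      using fibre[OF sub(1,2), of u v] fibre[OF sub(3,4), of u v]
      unfolding c prod.inject card by (simp only:)
    then show "count (image_mset ?f (mset_set V)) c = count (image_mset ?g (mset_set V)) c"
      using V by (simp add: count_image_mset' eq_commute flip: card_eq_sum sum.inter_filter)
  qed
  then obtain q where q: "q permutes V" and eq: "\<forall>x\<in>V. ?f x = ?g (q x)"
    using image_mset_eq_implies_permutes[OF V] by blast
  have "q ` A = {y \<in> q ` V. y \<in> C}" "q ` B = {y \<in> q ` V. y \<in> D}"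
    using eq sub by auto
  then have "q ` A = C" "q ` B = D"
    using sub permutes_image[OF q] by auto
  then show thesis using q that by blast
qed

text \<open>Relabelling the points maps the orders whose chosen two arcs are \<open>(A, B)\<close> injectively into those
whose chosen two arcs are \<open>(C, D)\<close>. As the symmetric group is transitive on pairs of \<open>k\<close>-sets with
intersection of a given size, every such pair arises from equally many orders, and the
probability of hitting \<open>\<F>\<close> twice is the proportion of pairs inside \<open>\<F>\<close>.\<close>

lemma average_over_orders:
  fixes V :: "'a set"
  assumes V: "finite V" "card V = n" and n: "0 < n" "k + d \<le> n" and F: "\<F> \<subseteq> nsets V k"
  shows "card (meeting_pairs (nsets V k) (k - d))
       * card {xs \<in> permutations_of_set V. arc k xs i \<in> \<F> \<and> arc k xs (i + int d) \<in> \<F>}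
       = fact n * card (meeting_pairs \<F> (k - d))"
proof -
  define X where "X = meeting_pairs (nsets V k) (k - d)"
  define Y where "Y = meeting_pairs \<F> (k - d)"
  define \<Phi> where "\<Phi> = (\<lambda>xs :: 'a list. (arc k xs i, arc k xs (i + int d)))"
  define N where "N P = card {xs \<in> permutations_of_set V. \<Phi> xs = P}" for P
  have order: "distinct xs \<and> set xs = V \<and> length xs = n \<and> xs \<noteq> []"
    if "xs \<in> permutations_of_set V" for xs
    using that V n by (auto simp: permutations_of_set_def distinct_card)
  have YX: "Y \<subseteq> X"
    using F by (auto simp: X_def Y_def meeting_pairs_def)
  have finX: "finite X"
    unfolding X_def by (intro finite_meeting_pairs finite_imp_finite_nsets V)
  have \<Phi>: "\<Phi> xs \<in> X" if "xs \<in> permutations_of_set V" for xs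
    using order[OF that] n arc_in_nsets[of xs k] card_arc_Int[of xs k d i]
    by (auto simp: X_def \<Phi>_def meeting_pairs_def)
  \<comment> \<open>By symmetry in \<open>P\<close> and \<open>Q\<close>, the inequality is enough to make \<open>N\<close> constant.\<close>
  have N_le: "N P \<le> N Q" if "P \<in> X" "Q \<in> X" for P Q
  proof -
    obtain A B C D where PQ: "P = (A, B)" "Q = (C, D)" by (metis surj_pair)
    have "A \<subseteq> V" "B \<subseteq> V" "C \<subseteq> V" "D \<subseteq> V" "card A = card C" "card B = card D"
      "card (A \<inter> B) = card (C \<inter> D)"
      using that by (auto simp: PQ X_def meeting_pairs_def nsets_def)
    then obtain q where q: "q permutes V" "q ` A = C" "q ` B = D"
      using permutes_pair_of_sets[OF V(1)] by metis
    have "map q ` {xs \<in> permutations_of_set V. \<Phi> xs = P} \<subseteq> {xs \<in> permutations_of_set V. \<Phi> xs = Q}"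
    proof (clarify, intro conjI)
      fix xs assume xs: "xs \<in> permutations_of_set V" and P: "P = \<Phi> xs"
      show "map q xs \<in> permutations_of_set V"
        using order[OF xs] permutes_image[OF q(1)] permutes_inj_on[OF q(1)]
        by (intro permutations_of_setI) (auto simp: distinct_map)
      show "\<Phi> (map q xs) = Q"
        using P q(2,3) order[OF xs] by (simp add: \<Phi>_def PQ arc_map)
    qed
    moreover have "inj_on (map q) {xs \<in> permutations_of_set V. \<Phi> xs = P}"
      using permutes_inj[OF q(1)] by (simp add: inj_on_def)
    ultimately show ?thesis
      unfolding N_def by (intro card_inj_on_le) auto
  qed
  have sum_N: "card {xs \<in> permutations_of_set V. \<Phi> xs \<in> Z} = (\<Sum>P\<in>Z. N P)" if "Z \<subseteq> X" for Z
  proof -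
    have "{xs \<in> permutations_of_set V. \<Phi> xs \<in> Z} = (\<Union>P\<in>Z. {xs \<in> permutations_of_set V. \<Phi> xs = P})"
      by auto
    then show ?thesis
      unfolding N_def using finite_subset[OF that finX] by (subst card_UN_disjoint[symmetric]) auto
  qed
  have "card X * card {xs \<in> permutations_of_set V. \<Phi> xs \<in> Y} = fact n * card Y"
  proof (cases "Y = {}")
    case False
    then obtain P where P: "P \<in> X" using YX by blast
    have N: "N Q = N P" if "Q \<in> X" for Q
      using that P N_le by (simp add: order_antisym)
    have "fact n = card {xs \<in> permutations_of_set V. \<Phi> xs \<in> X}"
    proof -
      have "{xs \<in> permutations_of_set V. \<Phi> xs \<in> X} = permutations_of_set V"
        using \<Phi> by auto
      then show ?thesis using V by simp
    qed
    also have "\<dots> = card X * N P"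
      using N by (simp add: sum_N)
    finally have total: "fact n = card X * N P" .
    have "card {xs \<in> permutations_of_set V. \<Phi> xs \<in> Y} = (\<Sum>Q\<in>Y. N P)"
      unfolding sum_N[OF YX] using N YX by (intro sum.cong) auto
    then show ?thesis by (simp add: total)
  qed simp
  moreover have "\<Phi> xs \<in> Y \<longleftrightarrow> arc k xs i \<in> \<F> \<and> arc k xs (i + int d) \<in> \<F>"
    if "xs \<in> permutations_of_set V" for xs
    using card_arc_Int[of xs k d i] order[OF that] n by (auto simp: Y_def \<Phi>_def meeting_pairs_def)
  ultimately show ?thesis
    unfolding X_def Y_def by (simp cong: conj_cong)
qed

section \<open>Periodic sets of positions\<close>

text \<open>Sliding the window by one loses the position \<open>a\<close> and gains \<open>a + n\<close>, and periodicity puts both or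
neither in \<open>J\<close>.\<close>

lemma card_periodic_window:
  fixes J :: "int set"
  assumes n: "0 < n" and per: "\<And>i. i + int n \<in> J \<longleftrightarrow> i \<in> J"
  shows "card (J \<inter> {a..<a + int n}) = card (J \<inter> {0..<int n})"
proof -
  have step: "card (J \<inter> {a..<a + int n}) = card (J \<inter> {a + 1..<a + 1 + int n})" for a
  proof -
    let ?R = "J \<inter> {a + 1..<a + int n}"
    have "{a..<a + int n} = insert a {a + 1..<a + int n}"
      "{a + 1..<a + 1 + int n} = insert (a + int n) {a + 1..<a + int n}"
      using n by auto
    then have "J \<inter> {a..<a + int n} = (if a \<in> J then insert a ?R else ?R)"
      "J \<inter> {a + 1..<a + 1 + int n} = (if a \<in> J then insert (a + int n) ?R else ?R)"
      using per[of a] by auto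
    then show ?thesis by simp
  qed
  show ?thesis
  proof (induction a rule: int_induct[where k = 0])
    case (step1 i)
    then show ?case using step[of i] by simp
  next
    case (step2 i)
    then show ?case using step[of "i - 1"] by simp
  qed simp
qed

lemma card_split_adjacent:
  fixes J :: "int set"
  shows "card (J \<inter> {a..<b}) = card ({i \<in> J. i + 1 \<in> J} \<inter> {a..<b}) + card ({i \<in> J. i + 1 \<notin> J} \<inter> {a..<b})"
proof -
  have "J \<inter> {a..<b} = ({i \<in> J. i + 1 \<in> J} \<inter> {a..<b}) \<union> ({i \<in> J. i + 1 \<notin> J} \<inter> {a..<b})"
    by auto
  also have "card \<dots> = card ({i \<in> J. i + 1 \<in> J} \<inter> {a..<b}) + card ({i \<in> J. i + 1 \<notin> J} \<inter> {a..<b})"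
    by (rule card_Un_disjoint) auto
  finally show ?thesis .
qed

text \<open>This is all that Katona's argument uses about the set \<open>J\<close> of starting points of arcs in the
family: the separation property says that two disjoint arcs cannot both belong to it.\<close>

locale periodic_separated =
  fixes J :: "int set" and n k :: nat
  assumes k: "1 \<le> k" and n: "2 * k \<le> n"
    and per: "i + int n \<in> J \<longleftrightarrow> i \<in> J"
    and sep: "i \<in> J \<Longrightarrow> i + int k \<le> j \<Longrightarrow> j \<le> i + int n - int k \<Longrightarrow> j \<notin> J"
begin

text \<open>All marks lie at distance less than \<open>k\<close> from a given mark \<open>i\<close>. In this range of length
\<open>2k - 1\<close>, two distinct positions with the same residue modulo \<open>k\<close> differ by exactly \<open>k\<close>, so they are not
both marked.\<close>

lemma card_le: "card (J \<inter> {0..<int n}) \<le> k"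
proof (cases "J \<inter> {0..<int n} = {}")
  case False
  then obtain i where i: "i \<in> J" by blast
  let ?W = "{i - int k..<i - int k + int n}"
  have near: "i - int k < j \<and> j < i + int k" if j: "j \<in> J \<inter> ?W" for j
  proof -
    have "j \<noteq> i - int k" using sep[of j i] i j n by auto
    moreover have "\<not> i + int k \<le> j" using sep[of i j] i j by auto
    ultimately show ?thesis using j by auto
  qed
  have "inj_on (\<lambda>j. j mod int k) (J \<inter> ?W)"
  proof (rule linorder_inj_onI')
    fix x y assume x: "x \<in> J \<inter> ?W" and y: "y \<in> J \<inter> ?W" and "x < y"
    show "x mod int k \<noteq> y mod int k"
    proof
      assume "x mod int k = y mod int k"
      then obtain m where m: "y - x = int k * m" by (metis dvdE mod_eq_dvd_iff)
      have "0 < y - x" "y - x < int k * 2"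
        using near[OF x] near[OF y] \<open>x < y\<close> by auto
      then have "0 < m" "m < 2"
        unfolding m using k by (simp_all add: zero_less_mult_iff)
      then have "m = 1" by simp
      then have "y = x + int k" using m by simp
      then show False using sep[of x y] x y n by auto
    qed
  qed
  moreover have "(\<lambda>j. j mod int k) ` (J \<inter> ?W) \<subseteq> {0..<int k}" using k by auto
  ultimately have "card (J \<inter> ?W) \<le> card {0..<int k}"
    by (intro card_inj_on_le) auto
  then show ?thesis
    using card_periodic_window[of n J "i - int k"] per k n by simp
qed simp

lemma last_before_gap:
  assumes "i \<in> J"
  obtains j where "j \<in> J" "j + 1 \<notin> J"
proof -
  have "\<exists>j. j \<in> J \<and> j + 1 \<notin> J"
  proof (rule ccontr)
    assume "\<not> ?thesis"
    then have succ: "j + 1 \<in> J" if "j \<in> J" for j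
      using that by blast
    have "i + int m \<in> J" for m
    proof (induction m)
      case (Suc m)
      then show ?case using succ[of "i + int m"] by (simp add: add_ac)
    qed (simp add: assms)
    then show False using sep[of i "i + int k"] assms n by simp
  qed
  then show thesis using that by blast
qed

lemma gaps_periodic: "i + int n \<in> {i \<in> J. i + 1 \<notin> J} \<longleftrightarrow> i \<in> {i \<in> J. i + 1 \<notin> J}"
proof -
  have "i + int n + 1 \<in> J \<longleftrightarrow> i + 1 \<in> J"
    using per[of "i + 1"] by (simp only: add_ac)
  then show ?thesis using per[of i] by blast
qed

lemma card_gaps_pos:
  assumes "J \<inter> {0..<int n} \<noteq> {}"
  shows "0 < card ({i \<in> J. i + 1 \<notin> J} \<inter> {0..<int n})"
proof -
  obtain j where "j \<in> J" "j + 1 \<notin> J" using last_before_gap assms by blast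
  then have "j \<in> {i \<in> J. i + 1 \<notin> J} \<inter> {j..<j + int n}" using k n by auto
  then have "0 < card ({i \<in> J. i + 1 \<notin> J} \<inter> {j..<j + int n})"
    by (subst card_gt_0_iff) auto
  then show ?thesis
    using card_periodic_window[OF _ gaps_periodic, of j] k n by simp
qed

text \<open>With \<open>r\<close> marks there is a marked position followed by an unmarked one unless \<open>r = 0\<close>; hence at
most \<open>r - 1\<close> marks are followed by a mark, and \<open>k (r - 1) \<le> (k - 1) r\<close> is just \<open>r \<le> k\<close>.\<close>

lemma adjacent_le: "k * card ({i \<in> J. i + 1 \<in> J} \<inter> {0..<int n}) \<le> (k - 1) * card (J \<inter> {0..<int n})"
proof (cases "J \<inter> {0..<int n} = {}")
  case True
  then have "{i \<in> J. i + 1 \<in> J} \<inter> {0..<int n} = {}" by auto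
  then show ?thesis by simp
next
  case False
  let ?c = "card (J \<inter> {0..<int n})"
  have "card ({i \<in> J. i + 1 \<in> J} \<inter> {0..<int n}) \<le> ?c - 1"
    using card_split_adjacent[of J 0 "int n"] card_gaps_pos[OF False] by linarith
  then have "k * card ({i \<in> J. i + 1 \<in> J} \<inter> {0..<int n}) \<le> k * ?c - k"
    using mult_le_mono2[of _ "?c - 1" k] by (simp add: diff_mult_distrib2)
  also have "\<dots> \<le> k * ?c - ?c" using card_le by simp
  finally show ?thesis by (simp add: diff_mult_distrib)
qed

text \<open>With \<open>k\<close> marks and \<open>k - 1\<close> consecutive pairs there is only one gap per period. The marks of a
period therefore form a single run, which ends at the mark \<open>a\<close> if \<open>a + 1\<close> is unmarked, and the run
has length \<open>k\<close>.\<close>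

lemma tight_interval:
  assumes full: "card (J \<inter> {0..<int n}) = k"
    and adj: "card ({i \<in> J. i + 1 \<in> J} \<inter> {0..<int n}) = k - 1"
    and a: "a \<in> J" "a + 1 \<notin> J" and t: "t < k"
  shows "a - int t \<in> J"
proof (rule ccontr)
  assume out: "a - int t \<notin> J"
  let ?D = "{i \<in> J. i + 1 \<notin> J}" and ?b = "a + 1 - int n"
  have n0: "0 < n" using k n by simp
  have "card (?D \<inter> {0..<int n}) = 1"
    using card_split_adjacent[of J 0 "int n"] full adj k by linarith
  then have "card (?D \<inter> {?b..<?b + int n}) = 1"
    using card_periodic_window[OF n0 gaps_periodic, of ?b] by simp
  then obtain c where c: "?D \<inter> {?b..<?b + int n} = {c}" by (auto simp: card_1_singleton_iff)
  \<comment> \<open>The window is placed so that the only gap, at \<open>a\<close>, is its last position.\<close>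
  have up: "i + 1 \<in> J" if "i \<in> J" "?b \<le> i" "i < a" for i
  proof (rule ccontr)
    assume "i + 1 \<notin> J"
    then have "i \<in> ?D \<inter> {?b..<?b + int n}" using that by simp
    moreover have "a \<in> ?D \<inter> {?b..<?b + int n}" using a n0 by simp
    ultimately show False using that unfolding c by simp
  qed
  have below: "i \<notin> J" if "?b \<le> i" "i \<le> a - int t" for i
  proof
    assume "i \<in> J"
    have "i + int m \<le> a - int t \<Longrightarrow> i + int m \<in> J" for m
    proof (induction m)
      case (Suc m)
      then have "i + int m + 1 \<in> J" using up[of "i + int m"] that by simp
      then show ?case by (simp add: add_ac)
    qed (use \<open>i \<in> J\<close> in simp)
    from this[of "nat (a - int t - i)"] show False using out that by simp
  qed
  have "J \<inter> {?b..<?b + int n} \<subseteq> {a - int t + 1..a}"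
  proof
    fix i assume "i \<in> J \<inter> {?b..<?b + int n}"
    then have "i \<in> J" "?b \<le> i" "i \<le> a" by simp_all
    moreover from this have "\<not> i \<le> a - int t" using below[of i] by blast
    ultimately show "i \<in> {a - int t + 1..a}" by simp
  qed
  then have "card (J \<inter> {?b..<?b + int n}) \<le> card {a - int t + 1..a}"
    by (intro card_mono) auto
  then show False
    using card_periodic_window[OF n0 per, of ?b] full t by simp
qed

end

section \<open>Exchanging one element\<close>

text \<open>Walk from \<open>G\<close> to \<open>G'\<close> by replacing one element at a time. All sets on the way contain
\<open>G \<inter> G'\<close>, and \<open>P\<close> has to fail for the first time at some step.\<close>

lemma exchange_step:
  assumes "finite V" "G \<in> nsets V k" "G' \<in> nsets V k" "P G" "\<not> P G'"
  obtains S a b where "a \<notin> S" "b \<notin> S" "insert a S \<in> nsets V k" "insert b S \<in> nsets V k"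
    "P (insert a S)" "\<not> P (insert b S)" "G \<inter> G' \<subseteq> S"
proof -
  have "\<exists>S a b. a \<notin> S \<and> b \<notin> S \<and> insert a S \<in> nsets V k \<and> insert b S \<in> nsets V k \<and>
    P (insert a S) \<and> \<not> P (insert b S) \<and> G \<inter> G' \<subseteq> S"
    using assms(2,4)
  proof (induction "card (G - G')" arbitrary: G rule: less_induct)
    case less
    have G: "G \<subseteq> V" "finite G" "card G = k" and G': "G' \<subseteq> V" "finite G'" "card G' = k"
      using less.prems(1) assms(3) by (auto simp: nsets_def)
    have "G \<noteq> G'" using less.prems assms by blast
    then have "\<not> G \<subseteq> G'" "\<not> G' \<subseteq> G" using G G' by (metis card_subset_eq)+
    then obtain x y where x: "x \<in> G" "x \<notin> G'" and y: "y \<in> G'" "y \<notin> G" by blast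
    define S where "S = G - {x}"
    have "0 < card G" using x G by (auto simp: card_gt_0_iff)
    then have S: "x \<notin> S" "y \<notin> S" "insert x S = G" "insert y S \<in> nsets V k" "G \<inter> G' \<subseteq> S"
      using x y G G' by (auto simp: S_def nsets_def)
    show ?case
    proof (cases "P (insert y S)")
      case True
      have "insert y S - G' \<subset> G - G'" using x y by (auto simp: S_def)
      then have "card (insert y S - G') < card (G - G')"
        using G by (intro psubset_card_mono) auto
      from less.hyps[OF this S(4) True] show ?thesis using S(5) by blast
    next
      case False
      then show ?thesis using S less.prems by blast
    qed
  qed
  then show thesis using that by blast
qed

section \<open>The two bounds\<close>

locale intersecting_uniform =
  fixes V :: "'a set" and \<F> :: "'a set set" and n k :: nat
  assumes finV: "finite V" and cardV: "card V = n"
    and k: "1 \<le> k" and n: "2 * k \<le> n"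
    and sub: "\<F> \<subseteq> nsets V k" and meet: "intersecting \<F>"
begin

abbreviation "orders \<equiv> permutations_of_set V"

text \<open>In the order \<open>xs\<close>, \<open>hits\<close> counts the arcs that belong to the family, and \<open>links\<close> counts the
pairs of consecutive arcs that both do; one period of positions lists every arc once.\<close>

definition "hits xs = card ({i. arc k xs i \<in> \<F>} \<inter> {0..<int n})"
definition "links xs = card ({i \<in> {i. arc k xs i \<in> \<F>}. i + 1 \<in> {i. arc k xs i \<in> \<F>}} \<inter> {0..<int n})"

lemma order:
  assumes "xs \<in> orders"
  shows "distinct xs" "set xs = V" "length xs = n" "xs \<noteq> []"
  using assms finV cardV k n by (auto simp: permutations_of_set_def distinct_card)

lemma members_meet: "A \<in> \<F> \<Longrightarrow> B \<in> \<F> \<Longrightarrow> A \<inter> B \<noteq> {}"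
  using meet by (auto simp: intersecting_def)

lemma arcs_periodic_separated:
  assumes "xs \<in> orders"
  shows "periodic_separated {i. arc k xs i \<in> \<F>} n k"
proof
  show "i + int n \<in> {i. arc k xs i \<in> \<F>} \<longleftrightarrow> i \<in> {i. arc k xs i \<in> \<F>}" for i
    using arc_periodic[of k xs i] order[OF assms] by simp
  show "j \<notin> {i. arc k xs i \<in> \<F>}"
    if "i \<in> {i. arc k xs i \<in> \<F>}" "i + int k \<le> j" "j \<le> i + int n - int k" for i j
    using arc_disjoint[of xs i k j] order[OF assms] that members_meet by auto
qed (use k n in auto)

lemma hits_le: "xs \<in> orders \<Longrightarrow> hits xs \<le> k"
  unfolding hits_def using periodic_separated.card_le[OF arcs_periodic_separated] .

lemma links_le: "xs \<in> orders \<Longrightarrow> k * links xs \<le> (k - 1) * hits xs"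
  unfolding hits_def links_def using periodic_separated.adjacent_le[OF arcs_periodic_separated] .

text \<open>The shift \<open>d = 0\<close> counts single members, as pairs of a set with itself, and \<open>d = 1\<close> counts pairs
meeting in \<open>k - 1\<close> points, so one averaging argument serves both.\<close>

lemma sum_positions:
  assumes d: "d \<le> 1"
  shows "card (meeting_pairs (nsets V k) (k - d)) *
      (\<Sum>xs\<in>orders. card ({i. arc k xs i \<in> \<F> \<and> arc k xs (i + int d) \<in> \<F>} \<inter> {0..<int n}))
    = n * fact n * card (meeting_pairs \<F> (k - d))"
proof -
  let ?Q = "\<lambda>xs i. arc k xs i \<in> \<F> \<and> arc k xs (i + int d) \<in> \<F>"
  have "(\<Sum>xs\<in>orders. card ({i. ?Q xs i} \<inter> {0..<int n}))
      = (\<Sum>xs\<in>orders. \<Sum>i\<in>{0..<int n}. if ?Q xs i then 1 else 0)"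
    by (simp add: sum.If_cases Int_commute)
  also have "\<dots> = (\<Sum>i\<in>{0..<int n}. \<Sum>xs\<in>orders. if ?Q xs i then 1 else 0)"
    by (rule sum.swap)
  also have "\<dots> = (\<Sum>i\<in>{0..<int n}. card {xs \<in> orders. ?Q xs i})"
    by (simp add: sum.If_cases Int_def)
  finally have "card (meeting_pairs (nsets V k) (k - d)) *
      (\<Sum>xs\<in>orders. card ({i. ?Q xs i} \<inter> {0..<int n}))
    = (\<Sum>i\<in>{0..<int n}. card (meeting_pairs (nsets V k) (k - d)) * card {xs \<in> orders. ?Q xs i})"
    by (simp only: sum_distrib_left)
  also have "\<dots> = (\<Sum>i\<in>{0..<int n}. fact n * card (meeting_pairs \<F> (k - d)))"
    by (intro sum.cong refl average_over_orders) (use finV cardV k n sub d in auto)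
  finally show ?thesis by simp
qed

lemma sum_hits: "(n choose k) * (\<Sum>xs\<in>orders. hits xs) = n * fact n * card \<F>"
  using sum_positions[of 0] finV cardV
  by (simp add: hits_def card_meeting_pairs_diagonal[OF order_refl] card_meeting_pairs_diagonal[OF sub] card_nsets)

lemma sum_links:
  "(n choose k) * (k * (n - k)) * (\<Sum>xs\<in>orders. links xs) = n * fact n * card (meeting_pairs \<F> (k - 1))"
  using sum_positions[of 1] card_meeting_pairs_nsets[OF finV cardV, of k] k n
  by (simp add: links_def)

lemma sum_hits_le: "(\<Sum>xs\<in>orders. hits xs) \<le> fact n * k"
  using sum_mono[of orders hits "\<lambda>_. k"] hits_le finV cardV by simp

lemma sum_links_le: "k * (\<Sum>xs\<in>orders. links xs) \<le> (k - 1) * (\<Sum>xs\<in>orders. hits xs)"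
  unfolding sum_distrib_left by (intro sum_mono links_le)

lemma absorb: "k * (n choose k) = n * ((n - 1) choose (k - 1))"
  using times_binomial_minus1_eq[of k n] k by simp

lemma positive: "0 < n" "0 < n choose k" "0 < n - k"
  using k n by auto

lemma card_le_star: "card \<F> \<le> (n - 1) choose (k - 1)"
proof -
  have "n * fact n * card \<F> \<le> (n choose k) * (fact n * k)"
    unfolding sum_hits[symmetric] using sum_hits_le by simp
  also have "\<dots> = n * fact n * ((n - 1) choose (k - 1))"
    using absorb by (simp add: mult_ac)
  finally show ?thesis using positive by simp
qed

text \<open>An average order satisfies \<open>k links \<le> (k - 1) hits\<close>. The average of \<open>links\<close> carries the factor
\<open>1 / (k (n - k))\<close>, because every \<open>k\<close>-set meets \<open>k (n - k)\<close> others in \<open>k - 1\<close> points.\<close>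

lemma adjacent_pairs_le: "card (meeting_pairs \<F> (k - 1)) \<le> (k - 1) * (n - k) * card \<F>"
proof -
  have "k * n * fact n * card (meeting_pairs \<F> (k - 1))
      = k * ((n choose k) * (k * (n - k)) * (\<Sum>xs\<in>orders. links xs))"
    unfolding sum_links by (simp only: mult_ac)
  also have "\<dots> = (n choose k) * (k * (n - k)) * (k * (\<Sum>xs\<in>orders. links xs))"
    by (simp only: mult_ac)
  also have "\<dots> \<le> (n choose k) * (k * (n - k)) * ((k - 1) * (\<Sum>xs\<in>orders. hits xs))"
    by (intro mult_le_mono2 sum_links_le)
  also have "\<dots> = k * (n - k) * (k - 1) * ((n choose k) * (\<Sum>xs\<in>orders. hits xs))"
    by (simp only: mult_ac)
  also have "\<dots> = k * n * fact n * ((k - 1) * (n - k) * card \<F>)"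
    unfolding sum_hits by (simp only: mult_ac)
  finally show ?thesis using positive k by (simp only: mult_le_cancel1) auto
qed

end

section \<open>The extremal families\<close>

lemma card_star:
  assumes "finite V" "a \<in> V" "1 \<le> k"
  shows "card {G \<in> nsets V k. a \<in> G} = (card V - 1) choose (k - 1)"
proof -
  have "{G \<in> nsets V k. a \<in> G} = insert a ` nsets (V - {a}) (k - 1)"
  proof (intro equalityI subsetI)
    fix G assume G: "G \<in> {G \<in> nsets V k. a \<in> G}"
    then have "G - {a} \<in> nsets (V - {a}) (k - 1)" "insert a (G - {a}) = G"
      by (auto simp: nsets_def)
    then show "G \<in> insert a ` nsets (V - {a}) (k - 1)" by (metis imageI)
  next
    fix G assume "G \<in> insert a ` nsets (V - {a}) (k - 1)"
    then obtain E where "G = insert a E" "E \<in> nsets (V - {a}) (k - 1)" by blast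
    moreover from this have "a \<notin> E" by (auto simp: nsets_def)
    ultimately show "G \<in> {G \<in> nsets V k. a \<in> G}"
      using assms by (auto simp: nsets_def)
  qed
  moreover have "inj_on (insert a) (nsets (V - {a}) (k - 1))"
    by (auto simp: inj_on_def nsets_def)
  ultimately show ?thesis
    using assms by (simp add: card_image card_nsets)
qed

locale tight_intersecting_uniform = intersecting_uniform +
  assumes full: "card \<F> = (n - 1) choose (k - 1)"
    and adjacent: "card (meeting_pairs \<F> (k - 1)) = (k - 1) * (n - k) * card \<F>"
begin

lemma sum_hits_eq: "(\<Sum>xs\<in>orders. hits xs) = fact n * k"
proof -
  have "(n choose k) * (\<Sum>xs\<in>orders. hits xs) = fact n * (n * ((n - 1) choose (k - 1)))"
    unfolding sum_hits full by (simp only: mult_ac)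
  also have "\<dots> = (n choose k) * (fact n * k)"
    unfolding absorb[symmetric] by (simp only: mult_ac)
  finally show ?thesis using positive by simp
qed

text \<open>The bounds hold for each order separately, so equality on average forces equality in every order.\<close>

lemma hits_eq: "xs \<in> orders \<Longrightarrow> hits xs = k"
  using sum_mono_inv[of hits orders "\<lambda>_. k"] hits_le finV cardV sum_hits_eq by simp

lemma sum_links_eq: "(\<Sum>xs\<in>orders. k * links xs) = (\<Sum>xs\<in>orders. (k - 1) * hits xs)"
proof -
  have "(n choose k) * (k * (n - k)) * (k * (\<Sum>xs\<in>orders. links xs))
      = k * ((n choose k) * (k * (n - k)) * (\<Sum>xs\<in>orders. links xs))"
    by (simp only: mult_ac)
  also have "\<dots> = k * (n - k) * (k - 1) * (n * fact n * card \<F>)"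
    unfolding sum_links adjacent by (simp only: mult_ac)
  also have "\<dots> = (n choose k) * (k * (n - k)) * ((k - 1) * (\<Sum>xs\<in>orders. hits xs))"
    unfolding sum_hits[symmetric] by (simp only: mult_ac)
  finally have "k * (\<Sum>xs\<in>orders. links xs) = (k - 1) * (\<Sum>xs\<in>orders. hits xs)"
    using positive k by simp
  then show ?thesis by (simp only: sum_distrib_left)
qed

lemma links_eq:
  assumes "xs \<in> orders"
  shows "links xs = k - 1"
proof -
  have "k * links xs = (k - 1) * hits xs"
    by (rule sum_mono_inv[OF sum_links_eq links_le assms]) simp_all
  then show ?thesis using hits_eq[OF assms] k by simp
qed

text \<open>In the order constructed here the arc from \<open>a\<close> is \<open>S \<union> {a}\<close> and the next one is
\<open>S \<union> {b}\<close>. So the run of \<open>k\<close> members ends with the arc from \<open>a\<close>, which means that it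
consists of the \<open>k\<close> arcs through \<open>a\<close>. The points of \<open>G\<close> in \<open>S\<close> are listed right
after \<open>a\<close>, those outside \<open>S\<close> right before \<open>a\<close>, so that \<open>G\<close> is one of these arcs.\<close>

lemma swap_forces:
  assumes S: "a \<notin> S" "b \<notin> S" and a: "insert a S \<in> \<F>" and b: "insert b S \<notin> \<F>" "insert b S \<in> nsets V k"
    and G: "G \<in> nsets V k" "a \<in> G" "b \<notin> G"
  shows "G \<in> \<F>"
proof -
  have ab: "a \<noteq> b" using a b by blast
  have inV: "a \<in> V" "b \<in> V" "S \<subseteq> V" "G \<subseteq> V" and fin: "finite S" "finite G" and cards: "card S = k - 1" "card G = k"
    using a b G sub S by (auto simp: nsets_def)
  define T where "T = V - insert a (insert b S)"
  have "finite (T \<inter> G)" "finite (T - G)" "finite (S \<inter> G)" "finite (S - G)"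
    using fin finV by (auto simp: T_def)
  then obtain ts us ss rs where lists:
    "set ts = T \<inter> G" "set us = T - G" "set ss = S \<inter> G" "set rs = S - G"
    "distinct ts" "distinct us" "distinct ss" "distinct rs"
    using finite_distinct_list by metis
  let ?xs = "ts @ (a # ss @ rs) @ b # us"
  have xs: "?xs \<in> orders"
  proof (rule permutations_of_setI)
    have "set ?xs = T \<union> insert a (insert b S)" by (auto simp: lists)
    also have "\<dots> = V" using inV by (auto simp: T_def)
    finally show "set ?xs = V" .
    have "a \<notin> T" "b \<notin> T" "S \<inter> T = {}" by (auto simp: T_def)
    then show "distinct ?xs" using lists S ab by auto
  qed
  have setS: "set (ss @ rs) = S" and setG: "set (ts @ a # ss) = G"
    using lists G inV by (auto simp: T_def)
  have "length (ss @ rs) = card S" "length (ts @ a # ss) = card G"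
    unfolding setS[symmetric] setG[symmetric] using xs
    by (intro distinct_card[symmetric]; auto simp: permutations_of_set_def)+
  then have len: "length (ss @ rs) = k - 1" "length (ts @ a # ss) = k" using cards by auto
  have "arc k ?xs (int (length ts)) = insert a S"
    using arc_append[of "a # ss @ rs" k ts "b # us"] len k setS by simp
  moreover have "arc k ?xs (int (length ts) + 1) = insert b S"
    using arc_append[of "ss @ rs @ [b]" k "ts @ [a]" us] len k setS by (simp add: add.commute)
  moreover have "arc k ?xs 0 = G"
    using arc_append[of "ts @ a # ss" k "[]" "rs @ b # us"] len setG by simp
  moreover have "int (length ts) - int (length ts) \<in> {i. arc k ?xs i \<in> \<F>}"
    if "int (length ts) \<in> {i. arc k ?xs i \<in> \<F>}" "int (length ts) + 1 \<notin> {i. arc k ?xs i \<in> \<F>}"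
    by (rule periodic_separated.tight_interval[OF arcs_periodic_separated[OF xs] _ _ that])
      (use hits_eq[OF xs] links_eq[OF xs] len in \<open>auto simp: hits_def links_def\<close>)
  ultimately show ?thesis using a b by simp
qed

text \<open>Take a member \<open>S \<union> {a}\<close> and a non-member \<open>S \<union> {b}\<close>. All \<open>k\<close>-sets with \<open>a\<close> and without
\<open>b\<close> are members, so a member \<open>H\<close> without \<open>a\<close> has to meet all of them; this is impossible if \<open>H\<close>
contains \<open>b\<close>, or if \<open>n > 2k\<close>, as there is room for such a set outside \<open>H\<close>. For \<open>n > 2k\<close> this
leaves a star. For \<open>n = 2k\<close> it remains to decide about the sets containing both \<open>a\<close> and \<open>b\<close>. If
all of them are members, the family contains the star of \<open>a\<close>. If none is, then no member contains
\<open>b\<close>. In both cases the number of members gives equality. A mixture is impossible, as shown in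
the proof.\<close>

theorem star_or_costar:
  "(\<exists>a\<in>V. \<F> = {G \<in> nsets V k. a \<in> G}) \<or> (n = 2 * k \<and> (\<exists>b\<in>V. \<F> = nsets (V - {b}) k))"
proof -
  have fin: "finite \<F>" using finV sub finite_imp_finite_nsets finite_subset by blast
  have "\<F> \<noteq> {}" using full k n by auto
  then obtain G where G: "G \<in> \<F>" by blast
  then have GV: "G \<in> nsets V k" using sub by blast
  have "k \<le> card (V - G)" using GV n cardV by (auto simp: nsets_def card_Diff_subset)
  then obtain G' where G': "G' \<subseteq> V - G" "card G' = k" "finite G'"
    by (rule obtain_subset_with_card_n)
  then have "G' \<in> nsets V k" by (auto simp: nsets_def)
  moreover have "G' \<notin> \<F>" using members_meet[OF G, of G'] G' by auto
  ultimately obtain S a b where S: "a \<notin> S" "b \<notin> S" "insert a S \<in> nsets V k" "insert b S \<in> nsets V k"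
    "insert a S \<in> \<F>" "insert b S \<notin> \<F>"
    using exchange_step[OF finV GV, of G' "\<lambda>G. G \<in> \<F>"] G by metis
  have ab: "a \<in> V" "b \<in> V" "a \<noteq> b" using S by (auto simp: nsets_def)
  have forced: "G \<in> \<F>" if "G \<in> nsets V k" "a \<in> G" "b \<notin> G" for G
    using swap_forces[OF S(1,2,5,6,4)] that by blast
  have avoid: False if H: "H \<in> \<F>" "a \<notin> H" "b \<in> H \<or> 2 * k < n" for H
  proof -
    have Hk: "H \<subseteq> V" "finite H" "card H = k" using H sub by (auto simp: nsets_def)
    have "card (V - (H \<union> {a, b})) = n - card (H \<union> {a, b})"
      using Hk ab cardV by (simp add: card_Diff_subset)
    moreover have "card (H \<union> {a, b}) = (if b \<in> H then k + 1 else k + 2)"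
      using Hk H ab by (auto simp: insert_absorb)
    ultimately have "k - 1 \<le> card (V - (H \<union> {a, b}))" using H n by auto
    then obtain R where R: "R \<subseteq> V - (H \<union> {a, b})" "card R = k - 1" "finite R"
      by (rule obtain_subset_with_card_n)
    have "a \<notin> R" using R by auto
    then have "insert a R \<in> nsets V k" "b \<notin> insert a R"
      using R k ab by (auto simp: nsets_def)
    then have "insert a R \<in> \<F>" using forced by blast
    then show False using members_meet[OF H(1), of "insert a R"] H R by auto
  qed
  have star: "card {G \<in> nsets V k. a \<in> G} = card \<F>"
    using card_star[OF finV ab(1) k] full cardV by simp
  have finstar: "finite {G \<in> nsets V k. a \<in> G}" using finV by (simp add: finite_imp_finite_nsets)
  consider "2 * k < n" | "n = 2 * k" "\<forall>G\<in>nsets V k. a \<in> G \<longrightarrow> b \<in> G \<longrightarrow> G \<in> \<F>"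
    | "n = 2 * k" "\<exists>G\<in>nsets V k. a \<in> G \<and> b \<in> G \<and> G \<notin> \<F>"
    using n by (metis le_neq_implies_less)
  then show ?thesis
  proof cases
    case 1
    then have "\<F> \<subseteq> {G \<in> nsets V k. a \<in> G}" using avoid sub by blast
    then have "\<F> = {G \<in> nsets V k. a \<in> G}"
      using card_subset_eq[OF finstar] star by metis
    then show ?thesis using ab by blast
  next
    case 2
    then have "{G \<in> nsets V k. a \<in> G} \<subseteq> \<F>" using forced by blast
    then have "\<F> = {G \<in> nsets V k. a \<in> G}"
      using card_subset_eq[OF fin] star by metis
    then show ?thesis using ab by blast
  next
    case 3
    then obtain G where G: "G \<in> nsets V k" "a \<in> G" "b \<in> G" "G \<notin> \<F>" by blast
    have "b \<notin> H" if H: "H \<in> \<F>" for H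
    proof
      assume "b \<in> H"
      then have "a \<in> H" using avoid H by blast
      \<comment> \<open>An exchange between two \<open>k\<close>-sets containing \<open>a\<close> and \<open>b\<close> yields another pair \<open>c\<close>, \<open>d\<close> to
        which \<open>swap_forces\<close> applies. It makes a member of a set that contains \<open>c\<close> and \<open>b\<close>, but
        neither \<open>d\<close> nor \<open>a\<close>, and a member with \<open>b\<close> and without \<open>a\<close> is excluded.\<close>
      have "H \<in> nsets V k" using H sub by blast
      then obtain S' c d where S': "c \<notin> S'" "d \<notin> S'" "insert c S' \<in> nsets V k" "insert d S' \<in> nsets V k"
        "insert c S' \<in> \<F>" "insert d S' \<notin> \<F>" "H \<inter> G \<subseteq> S'"
        using exchange_step[OF finV _ G(1), of H "\<lambda>G. G \<in> \<F>"] G H by metis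
      have abS: "a \<in> S'" "b \<in> S'" using S'(7) \<open>a \<in> H\<close> \<open>b \<in> H\<close> G by auto
      have "c \<noteq> d" using S' by auto
      have V': "c \<in> V" "d \<in> V" "finite S'" "card S' = k - 1" using S' by (auto simp: nsets_def)
      have "card {a, b} \<le> card S'" using abS V' by (intro card_mono) auto
      then have k3: "3 \<le> k" using V' ab by simp
      have "a \<noteq> c" "a \<noteq> d" "b \<noteq> c" "b \<noteq> d" using abS S'(1,2) by blast+
      then have "card {a, b, c, d} = 4" using ab(3) \<open>c \<noteq> d\<close> by simp
      then have "card (V - {a, b, c, d}) = n - 4" using V' ab cardV by (simp add: card_Diff_subset)
      then have "k - 2 \<le> card (V - {a, b, c, d})" using k3 3 by simp
      then obtain R where R: "R \<subseteq> V - {a, b, c, d}" "card R = k - 2" "finite R"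
        by (rule obtain_subset_with_card_n)
      have "b \<notin> R" "c \<notin> R" "b \<noteq> c" using R abS S' by auto
      then have "insert c (insert b R) \<in> nsets V k"
        using R k3 ab V' by (auto simp: nsets_def)
      moreover have "d \<notin> insert c (insert b R)" using R abS S' \<open>c \<noteq> d\<close> by auto
      ultimately have "insert c (insert b R) \<in> \<F>"
        using swap_forces[OF S'(1,2,5,6,4)] by blast
      moreover have "a \<notin> insert c (insert b R)" using R abS S' ab by auto
      ultimately show False using avoid by blast
    qed
    then have "\<F> \<subseteq> nsets (V - {b}) k" using sub by (auto simp: nsets_def)
    moreover have "card (nsets (V - {b}) k) = card \<F>"
      using full cardV finV ab 3 binomial_symmetric[of k "2 * k - 1"] k by (simp add: card_nsets)
    moreover have "finite (nsets (V - {b}) k)" using finV by (simp add: finite_imp_finite_nsets)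
    ultimately have "\<F> = nsets (V - {b}) k" using card_subset_eq by metis
    then show ?thesis using 3 ab by blast
  qed
qed

end

section \<open>The extremal value of the sum of squared degrees\<close>

lemma family_iso_transpose:
  assumes "a \<in> V" "b \<in> V"
    and "\<And>F. F \<in> \<F> \<Longrightarrow> Transposition.transpose a b ` F \<in> \<G>"
    and "\<And>G. G \<in> \<G> \<Longrightarrow> Transposition.transpose a b ` G \<in> \<F>"
  shows "family_iso V \<F> \<G>"
proof -
  let ?t = "Transposition.transpose a b"
  have inv: "?t ` ?t ` G = G" for G by (simp add: image_image)
  have "(\<lambda>F. ?t ` F) ` \<F> = \<G>"
  proof (intro equalityI subsetI)
    fix G assume "G \<in> \<G>"
    then show "G \<in> (\<lambda>F. ?t ` F) ` \<F>"
      using assms(4) inv by (metis imageI)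
  qed (use assms in auto)
  then show ?thesis
    unfolding family_iso_def using permutes_swap_id[OF assms(1,2)] by blast
qed

lemma transpose_image_nsets:
  assumes "F \<in> nsets A k" "\<And>x. x \<in> A \<Longrightarrow> Transposition.transpose a b x \<in> B"
  shows "Transposition.transpose a b ` F \<in> nsets B k"
proof -
  have "card (Transposition.transpose a b ` F) = card F" by (intro card_image inj_on_transpose)
  then show ?thesis using assms by (auto simp: nsets_def)
qed

theorem theorem1p3:
  fixes n k :: nat and \<F> :: "nat set set"
  assumes "k \<ge> 1" and "n \<ge> 2 * k"
    and "\<F> \<subseteq> nsets {1..n} k"
    and "intersecting \<F>"
  shows "co2 n k \<F> \<le> ((n - 1) choose (k - 1)) * (1 + (n - k + 1) * (k - 1)) \<and>
    (n > 2 * k \<longrightarrow>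
      co2 n k \<F> = ((n - 1) choose (k - 1)) * (1 + (n - k + 1) * (k - 1)) \<longrightarrow>
      family_iso {1..n} \<F> {F \<in> nsets {1..n} k. 1 \<in> F}) \<and>
    (n = 2 * k \<longrightarrow>
      co2 n k \<F> = ((n - 1) choose (k - 1)) * (1 + (n - k + 1) * (k - 1)) \<longrightarrow>
      family_iso {1..2 * k} \<F> {F \<in> nsets {1..2 * k} k. 1 \<in> F} \<or>
      family_iso {1..2 * k} \<F> (nsets {1..2 * k - 1} k))"
proof -
  interpret intersecting_uniform "{1..n}" \<F> n k
    by standard (use assms in auto)
  let ?c = "(n - 1) choose (k - 1)" and ?e = "card (meeting_pairs \<F> (k - 1))"
  have co2: "co2 n k \<F> = k * card \<F> + ?e"
    unfolding co2_def by (rule sum_degree_squares) (use assms in auto)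
  have "1 + (n - k + 1) * (k - 1) = k + (k - 1) * (n - k)"
    using k by (cases k) (auto simp: algebra_simps)
  then have bound: "?c * (1 + (n - k + 1) * (k - 1)) = k * ?c + (k - 1) * (n - k) * ?c"
    by (simp add: algebra_simps)
  have e: "?e \<le> (k - 1) * (n - k) * ?c"
    using adjacent_pairs_le card_le_star by (meson le_trans mult_le_mono2)
  have le: "co2 n k \<F> \<le> ?c * (1 + (n - k + 1) * (k - 1))"
    unfolding co2 bound by (intro add_mono mult_le_mono2 card_le_star e)
  have extremal: "(\<exists>a\<in>{1..n}. \<F> = {G \<in> nsets {1..n} k. a \<in> G}) \<or>
      (n = 2 * k \<and> (\<exists>b\<in>{1..n}. \<F> = nsets ({1..n} - {b}) k))"
    if eq: "co2 n k \<F> = ?c * (1 + (n - k + 1) * (k - 1))"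
  proof -
    have "k * card \<F> \<le> k * ?c" using card_le_star by simp
    then have eqs: "k * card \<F> = k * ?c" "?e = (k - 1) * (n - k) * ?c"
      using eq e unfolding co2 bound by linarith+
    then have "card \<F> = ?c" using k by simp
    then interpret tight_intersecting_uniform "{1..n}" \<F> n k
      by unfold_locales (use eqs in auto)
    show ?thesis by (rule star_or_costar)
  qed
  have star: "family_iso {1..n} \<F> {F \<in> nsets {1..n} k. 1 \<in> F}"
    if "a \<in> {1..n}" "\<F> = {G \<in> nsets {1..n} k. a \<in> G}" for a
  proof (rule family_iso_transpose)
    show "a \<in> {1..n}" and one: "1 \<in> {1..n}" using that by auto
    have V: "Transposition.transpose a 1 x \<in> {1..n}" if "x \<in> {1..n}" for x
      using that \<open>a \<in> {1..n}\<close> one by (auto simp: Transposition.transpose_def)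
    have image: "Transposition.transpose a 1 ` F \<in> nsets {1..n} k" if "F \<in> nsets {1..n} k" for F
      using that V by (rule transpose_image_nsets)
    show "Transposition.transpose a 1 ` F \<in> {F \<in> nsets {1..n} k. 1 \<in> F}" if "F \<in> \<F>" for F
    proof -
      have "F \<in> nsets {1..n} k" "a \<in> F" using that \<open>\<F> = _\<close> by auto
      then show ?thesis
        using image by (auto intro!: rev_image_eqI[of a])
    qed
    show "Transposition.transpose a 1 ` G \<in> \<F>" if "G \<in> {F \<in> nsets {1..n} k. 1 \<in> F}" for G
    proof -
      have "G \<in> nsets {1..n} k" "1 \<in> G" using that by auto
      then have "Transposition.transpose a 1 ` G \<in> nsets {1..n} k" "a \<in> Transposition.transpose a 1 ` G"
        using image by (auto intro!: rev_image_eqI[of 1])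
      then show ?thesis using \<open>\<F> = _\<close> by blast
    qed
  qed
  have costar: "family_iso {1..2 * k} \<F> (nsets {1..2 * k - 1} k)"
    if "n = 2 * k" "b \<in> {1..n}" "\<F> = nsets ({1..n} - {b}) k" for b
  proof (rule family_iso_transpose)
    show "b \<in> {1..2 * k}" "2 * k \<in> {1..2 * k}" using that k by auto
    have V: "Transposition.transpose b (2 * k) x \<in> {1..2 * k - 1}" if "x \<in> {1..n} - {b}" for x
      using that \<open>n = 2 * k\<close> \<open>b \<in> {1..n}\<close> by (auto simp: Transposition.transpose_def)
    have V': "Transposition.transpose b (2 * k) x \<in> {1..n} - {b}" if "x \<in> {1..2 * k - 1}" for x
      using that \<open>n = 2 * k\<close> \<open>b \<in> {1..n}\<close> by (auto simp: Transposition.transpose_def)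
    show "Transposition.transpose b (2 * k) ` F \<in> nsets {1..2 * k - 1} k" if "F \<in> \<F>" for F
      using that V unfolding \<open>\<F> = _\<close> by (rule transpose_image_nsets)
    show "Transposition.transpose b (2 * k) ` G \<in> \<F>" if "G \<in> nsets {1..2 * k - 1} k" for G
      using that V' unfolding \<open>\<F> = _\<close> by (rule transpose_image_nsets)
  qed
  show ?thesis
    using le extremal star costar by blast
qed

end
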